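(* Let $f=P_{A_3}^2:\mathbb C^3\to\mathbb C^3$ with critical set $C\subset\mathbb C^3$. The set $\mathscr Q$ coincides with $f(C)\cap R_3$ by a coordinate transformation, namely $\beta=-z_1$, $2\gamma=z_2$: a pair $(\beta,\gamma)\in\mathbb C\times\mathbb R$ lies in $\mathscr Q$ if and only if the point $(z_1,z_2,\bar z_1)=(-\beta,2\gamma,-\bar\beta)$ lies in $f(C)\cap R_3$.
   Context: Every real binary quartic form $ax^4+4bx^3y+6cx^2y^2+4dxy^3+ey^4$ can be written uniquely as $\mathrm{Re}(\alpha z^4+\beta z^3\bar z+\gamma z^2\bar z^2)$ with $z=x+iy$, $\alpha,\beta\in\mathbb C$, $\gamma\in\mathbb R$. $\mathscr Q$ (the "Holy Grail" of Poston and Stewart) is the cross-section $\alpha=1$ of the discriminant locus, i.e. the set of $(\beta,\gamma)\in\mathbb C\times\mathbb R$ such that the real binary quartic form $\mathrm{Re}(z^4+\beta z^3\bar z+\gamma z^2\bar z^2)$ has zero discriminant. For $t_1,t_2,t_3\in\mathbb C\setminus\{0\}$ let $\Phi_1(t_1,t_2,t_3)=(z_1,z_2,z_3)$ be the first three elementary symmetric functions of $t_1,t_2,t_3,t_4=1/(t_1t_2t_3)$. $P_{A_3}^d$ is the polynomial map determined by $P_{A_3}^d(\Phi_1(t_1,t_2,t_3))=\Phi_1(t_1^d,t_2^d,t_3^d)$; explicitly $P_{A_3}^2(z_1,z_2,z_3)=(z_1^2-2z_2,\ z_2^2-2z_1z_3+2,\ z_3^2-2z_2)$. $R_3=\{(z_1,z_2,\bar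 z_1):z_1\in\mathbb C,z_2\in\mathbb R\}$. *)

theory Defs
  imports
    "HOL-Analysis.Analysis"
    "HOL-Computational_Algebra.Fundamental_Theorem_Algebra"
begin

text \<open>Binary quartic forms are written with binomial coefficients, as
  \<open>a x^4 + 4 b x^3 y + 6 c x^2 y^2 + 4 d x y^3 + e y^4\<close>. The discriminant is that of the
  \<^emph>\<open>form\<close> (so a double zero at infinity counts, and the case \<open>a = 0\<close> needs no special
  treatment), given by the classical formula \<open>256 (I^3 - 27 J^2)\<close> in the invariants
  \<open>I = a e - 4 b d + 3 c^2\<close> and \<open>J = a c e + 2 b c d - a d^2 - b^2 e - c^3\<close>.\<close>

definition quartic_form :: "'a::comm_ring_1 \<Rightarrow> 'a \<Rightarrow> 'a \<Rightarrow> 'a \<Rightarrow> 'a \<Rightarrow> 'a \<Rightarrow> 'a \<Rightarrow> 'a" where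
  "quartic_form a b c d e x y =
     a * x^4 + 4 * b * x^3 * y + 6 * c * x^2 * y^2 + 4 * d * x * y^3 + e * y^4"

definition quartic_discriminant :: "'a::comm_ring_1 \<Rightarrow> 'a \<Rightarrow> 'a \<Rightarrow> 'a \<Rightarrow> 'a \<Rightarrow> 'a" where
  "quartic_discriminant a b c d e =
     256 * ((a * e - 4 * b * d + 3 * c^2)^3
          - 27 * (a * c * e + 2 * b * c * d - a * d^2 - b^2 * e - c^3)^2)"

text \<open>The normalisation agrees with the product formula for the discriminant of
  \<open>a (x - r y) (x - s y) (x - t y) (x - u y)\<close>.\<close>

lemma quartic_discriminant_roots:
  fixes a b c d e r s t u :: complex
  assumes "4 * b = - a * (r + s + t + u)"
    and "6 * c = a * (r * s + r * t + r * u + s * t + s * u + t * u)"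
    and "4 * d = - a * (r * s * t + r * s * u + r * t * u + s * t * u)"
    and "e = a * (r * s * t * u)"
  shows "quartic_discriminant a b c d e =
    a^6 * ((r - s) * (r - t) * (r - u) * (s - t) * (s - u) * (t - u))^2"
proof -
  have b: "b = - a * (r + s + t + u) / 4" using assms(1) by (simp add: field_simps)
  have c: "c = a * (r * s + r * t + r * u + s * t + s * u + t * u) / 6" using assms(2) by (simp add: field_simps)
  have d: "d = - a * (r * s * t + r * s * u + r * t * u + s * t * u) / 4" using assms(3) by (simp add: field_simps)
  show ?thesis
    unfolding quartic_discriminant_def b c d assms(4) by (simp add: field_simps) algebra
qed

text \<open>The quantified coefficients are the unique ones of the real quartic form in question
  (see the two lemmas below).\<close>

definition holy_grail :: "(complex \<times> real) set" where
  "holy_grail = {(\<beta>, \<gamma>). \<exists>a b c d e :: real.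
     (\<forall>x y. quartic_form a b c d e x y =
        (let z = Complex x y in
           Re (z^4 + \<beta> * z^3 * cnj z + of_real \<gamma> * z^2 * (cnj z)^2))) \<and>
     quartic_discriminant a b c d e = 0}"

lemma grail_form_coefficients:
  "quartic_form (1 + Re \<beta> + \<gamma>) (- Im \<beta> / 2) (\<gamma> / 3 - 1) (- Im \<beta> / 2) (1 - Re \<beta> + \<gamma>) x y =
     (let z = Complex x y in Re (z^4 + \<beta> * z^3 * cnj z + of_real \<gamma> * z^2 * (cnj z)^2))"
  unfolding quartic_form_def Let_def
  by (simp add: power4_eq_xxxx power3_eq_cube power2_eq_square) algebra

lemma quartic_form_coefficients_unique:
  fixes a b c d e a' b' c' d' e' :: real
  assumes "\<forall>x y. quartic_form a b c d e x y = quartic_form a' b' c' d' e' x y"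
  shows "a = a'" "b = b'" "c = c'" "d = d'" "e = e'"
  using assms[rule_format, of 1 0] assms[rule_format, of 0 1] assms[rule_format, of 1 1]
    assms[rule_format, of 1 "-1"] assms[rule_format, of 1 2]
  by (simp_all add: quartic_form_def)

definition Phi1 :: "complex \<Rightarrow> complex \<Rightarrow> complex \<Rightarrow> complex^3" where
  "Phi1 t1 t2 t3 =
     (let t4 = 1 / (t1 * t2 * t3) in
      vector [t1 + t2 + t3 + t4,
              t1*t2 + t1*t3 + t1*t4 + t2*t3 + t2*t4 + t3*t4,
              t1*t2*t3 + t1*t2*t4 + t1*t3*t4 + t2*t3*t4])"

text \<open>Since \<open>Phi1\<close> maps the triples of nonzero numbers onto \<open>\<complex>\<^sup>3\<close> (lemma \<open>Phi1_surj\<close>),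
  the semiconjugacy alone determines the map; that it is polynomial need not be required.\<close>

definition P_A3 :: "nat \<Rightarrow> complex^3 \<Rightarrow> complex^3" where
  "P_A3 d = (THE P. \<forall>t1 t2 t3. t1 \<noteq> 0 \<longrightarrow> t2 \<noteq> 0 \<longrightarrow> t3 \<noteq> 0 \<longrightarrow>
     P (Phi1 t1 t2 t3) = Phi1 (t1^d) (t2^d) (t3^d))"

lemma Phi1_surj: "\<exists>t1 t2 t3. t1 \<noteq> 0 \<and> t2 \<noteq> 0 \<and> t3 \<noteq> 0 \<and> Phi1 t1 t2 t3 = z"
proof -
  have root: "\<exists>x. poly p x = 0" if "degree p > 0" for p :: "complex poly"
    using that fundamental_theorem_of_algebra[of p] constant_degree[of p] by auto
  define z1 z2 z3 where z: "z1 = z$1" "z2 = z$2" "z3 = z$3"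
  obtain a where a: "poly [:1, - z3, z2, - z1, 1:] a = 0"
    using root[of "[:1, - z3, z2, - z1, 1:]"] by auto
  define p q r where "p = a - z1" and "q = a * p + z2" and "r = a * q - z3"
  have ar: "a * r = - 1"
    using a by (simp add: p_def q_def r_def algebra_simps add_eq_0_iff)
  obtain b where b: "poly [:r, q, p, 1:] b = 0"
    using root[of "[:r, q, p, 1:]"] by auto
  define u v where "u = b + p" and "v = b * u + q"
  have bv: "b * v = - r"
    using b by (simp add: u_def v_def algebra_simps add_eq_0_iff)
  obtain c where c: "poly [:v, u, 1:] c = 0"
    using root[of "[:v, u, 1:]"] by auto
  define d where "d = - u - c"
  have cd: "c * d = v"
    using c unfolding d_def by simp algebra
  have prod: "a * b * c * d = 1"
    using ar bv cd by algebra
  have nz: "a \<noteq> 0" "b \<noteq> 0" "c \<noteq> 0"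
    using prod by auto
  have d4: "1 / (a * b * c) = d"
    using prod nz by (simp add: field_simps)
  have "a + b + c + d = z1"
    by (simp add: d_def u_def p_def)
  moreover have "a*b + a*c + a*d + b*c + b*d + c*d = z2"
  proof -
    have "a*b + a*c + a*d + b*c + b*d + c*d = a*b + (a + b) * (c + d) + c*d"
      by algebra
    also have "\<dots> = a*b - (a + b) * u + v"
      unfolding cd by (simp add: d_def)
    also have "\<dots> = z2"
      by (simp add: u_def v_def q_def algebra_simps)
    finally show ?thesis .
  qed
  moreover have "a*b*c + a*b*d + a*c*d + b*c*d = z3"
    using cd bv d_def u_def v_def p_def q_def r_def by algebra
  ultimately have "Phi1 a b c = z"
    unfolding Phi1_def Let_def d4 by (simp add: z vec_eq_iff forall_3)
  with nz show ?thesis by blast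
qed

lemma P_A3_2:
  "P_A3 2 = (\<lambda>z. vector [(z$1)^2 - 2 * z$2, (z$2)^2 - 2 * z$1 * z$3 + 2, (z$3)^2 - 2 * z$2])"
proof -
  define F :: "complex^3 \<Rightarrow> complex^3"
    where "F = (\<lambda>z. vector [(z$1)^2 - 2 * z$2, (z$2)^2 - 2 * z$1 * z$3 + 2, (z$3)^2 - 2 * z$2])"
  have F: "F (Phi1 t1 t2 t3) = Phi1 (t1^2) (t2^2) (t3^2)"
    if "t1 \<noteq> 0" "t2 \<noteq> 0" "t3 \<noteq> 0" for t1 t2 t3
  proof -
    define t4 where "t4 = 1 / (t1 * t2 * t3)"
    have p: "t1 * t2 * t3 * t4 = 1" using that by (simp add: t4_def)
    have sq: "1 / (t1^2 * t2^2 * t3^2) = t4^2" by (simp add: t4_def power_mult_distrib power_divide)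
    have e1: "(t1 + t2 + t3 + t4)^2 - 2 * (t1*t2 + t1*t3 + t1*t4 + t2*t3 + t2*t4 + t3*t4) = t1^2 + t2^2 + t3^2 + t4^2"
      by algebra
    have e2: "(t1*t2 + t1*t3 + t1*t4 + t2*t3 + t2*t4 + t3*t4)^2
        - 2 * (t1 + t2 + t3 + t4) * (t1*t2*t3 + t1*t2*t4 + t1*t3*t4 + t2*t3*t4) + 2
      = t1^2*t2^2 + t1^2*t3^2 + t1^2*t4^2 + t2^2*t3^2 + t2^2*t4^2 + t3^2*t4^2"
      using p by algebra
    have e3: "(t1*t2*t3 + t1*t2*t4 + t1*t3*t4 + t2*t3*t4)^2 - 2 * (t1*t2 + t1*t3 + t1*t4 + t2*t3 + t2*t4 + t3*t4)
      = t1^2*t2^2*t3^2 + t1^2*t2^2*t4^2 + t1^2*t3^2*t4^2 + t2^2*t3^2*t4^2"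
      using p by algebra
    show ?thesis
      unfolding F_def Phi1_def Let_def sq t4_def[symmetric]
      using e1 e2 e3 by (simp add: vec_eq_iff forall_3)
  qed
  have "P_A3 2 = F"
    unfolding P_A3_def
  proof (rule the_equality)
    fix P assume P: "\<forall>t1 t2 t3. t1 \<noteq> 0 \<longrightarrow> t2 \<noteq> 0 \<longrightarrow> t3 \<noteq> 0 \<longrightarrow>
      P (Phi1 t1 t2 t3) = Phi1 (t1^2) (t2^2) (t3^2)"
    show "P = F"
      using P F Phi1_surj by (metis (no_types, lifting) ext)
  qed (use F in blast)
  then show ?thesis by (simp add: F_def)
qed

definition complex_jacobian :: "(complex^'n \<Rightarrow> complex^'n) \<Rightarrow> complex^'n \<Rightarrow> complex^'n^'n" where
  "complex_jacobian f p =
     (\<chi> i j. deriv (\<lambda>w. f (\<chi> k. if k = j then w else p $ k) $ i) (p $ j))"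

text \<open>Meaningful for holomorphic \<open>f\<close> only, as \<open>deriv\<close> is unspecified at points where a
  partial derivative does not exist.\<close>

definition critical_set :: "(complex^'n \<Rightarrow> complex^'n) \<Rightarrow> (complex^'n) set" where
  "critical_set f = {p. det (complex_jacobian f p) = 0}"

definition R3 :: "(complex^3) set" where
  "R3 = {vector [z1, of_real z2, cnj z1] | z1 z2. True}"

end

theory Submission
  imports Defs
begin

text \<open>
  Put \<open>z = \<Phi>\<^sub>1(t)\<close>, so that \<open>t\<^sub>1, \<dots>, t\<^sub>4\<close> with \<open>t\<^sub>1t\<^sub>2t\<^sub>3t\<^sub>4 = 1\<close> are the roots of
  \<open>X^4 - z\<^sub>1 X^3 + z\<^sub>2 X^2 - z\<^sub>3 X + 1\<close>. The Jacobian determinant of \<open>f\<close> is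
  \<open>8 (z\<^sub>1z\<^sub>2z\<^sub>3 - z\<^sub>1\<^sup>2 - z\<^sub>3\<^sup>2)\<close>, which at \<open>\<Phi>\<^sub>1(t)\<close> factors as 8 times the product of the sums
  \<open>t\<^sub>i + t\<^sub>j\<close>. Hence \<open>z\<close> is critical if and only if two of the roots are opposite; since \<open>f\<close>
  squares the roots, the quartic of \<open>f(z)\<close> then has a double root. Conversely, if the quartic
  of a point has a double root, then square roots of its four roots can be taken with product 1,
  those over the double root agree up to sign, and changing two signs at once (which preserves
  the product) makes them opposite. So \<open>f(C)\<close> is the discriminant locus of these quartics
  (lemma \<open>image_critical_set_P_A3_2\<close>).

  On the other side, in the variables \<open>z\<close> and its conjugate the real form
  \<open>Re (z^4 + \<beta> z^3 cnj z + \<gamma> z^2 (cnj z)^2)\<close> is half of the binary quartic form with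
  coefficients \<open>1, \<beta>, 2\<gamma>, cnj \<beta>, 1\<close>. As the discriminant is an invariant, its vanishing does
  not depend on the coordinates (lemma \<open>holy_grail_iff\<close>), and comparing coefficients gives
  \<open>(z\<^sub>1, z\<^sub>2, z\<^sub>3) = (-\<beta>, 2\<gamma>, -cnj \<beta>)\<close>, which is the general point of \<open>R\<^sub>3\<close>.
\<close>

lemma Phi1_components:
  assumes "t1 * t2 * t3 * t4 = 1"
  shows "Phi1 t1 t2 t3 $ 1 = t1 + t2 + t3 + t4"
    and "Phi1 t1 t2 t3 $ 2 = t1*t2 + t1*t3 + t1*t4 + t2*t3 + t2*t4 + t3*t4"
    and "Phi1 t1 t2 t3 $ 3 = t1*t2*t3 + t1*t2*t4 + t1*t3*t4 + t2*t3*t4"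
proof -
  have "t1 * t2 * t3 \<noteq> 0" using assms by auto
  then have "1 / (t1 * t2 * t3) = t4" using assms by (simp add: divide_eq_eq mult_ac)
  then show "Phi1 t1 t2 t3 $ 1 = t1 + t2 + t3 + t4"
    and "Phi1 t1 t2 t3 $ 2 = t1*t2 + t1*t3 + t1*t4 + t2*t3 + t2*t4 + t3*t4"
    and "Phi1 t1 t2 t3 $ 3 = t1*t2*t3 + t1*t2*t4 + t1*t3*t4 + t2*t3*t4"
    by (simp_all add: Phi1_def Let_def)
qed

lemma Phi1_surj_unimodular:
  obtains t1 t2 t3 t4 where "t1 * t2 * t3 * t4 = 1" "Phi1 t1 t2 t3 = z"
proof -
  obtain t1 t2 t3 where "t1 \<noteq> 0" "t2 \<noteq> 0" "t3 \<noteq> 0" "Phi1 t1 t2 t3 = z"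
    using Phi1_surj by blast
  then show thesis using that[of t1 t2 t3 "1 / (t1 * t2 * t3)"] by simp
qed

lemma P_A3_2_Phi1:
  assumes "t1 * t2 * t3 * t4 = 1"
  shows "P_A3 2 (Phi1 t1 t2 t3) = Phi1 (t1^2) (t2^2) (t3^2)"
proof -
  have "t1^2 * t2^2 * t3^2 * t4^2 = 1"
    using assms by (simp flip: power_mult_distrib)
  note c = Phi1_components[OF assms] Phi1_components[OF this]
  have "(t1 + t2 + t3 + t4)^2 - 2 * (t1*t2 + t1*t3 + t1*t4 + t2*t3 + t2*t4 + t3*t4)
      = t1^2 + t2^2 + t3^2 + t4^2"
    by algebra
  moreover have "(t1*t2 + t1*t3 + t1*t4 + t2*t3 + t2*t4 + t3*t4)^2
      - 2 * (t1 + t2 + t3 + t4) * (t1*t2*t3 + t1*t2*t4 + t1*t3*t4 + t2*t3*t4) + 2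
      = t1^2*t2^2 + t1^2*t3^2 + t1^2*t4^2 + t2^2*t3^2 + t2^2*t4^2 + t3^2*t4^2"
    using assms by algebra
  moreover have "(t1*t2*t3 + t1*t2*t4 + t1*t3*t4 + t2*t3*t4)^2
      - 2 * (t1*t2 + t1*t3 + t1*t4 + t2*t3 + t2*t4 + t3*t4)
      = t1^2*t2^2*t3^2 + t1^2*t2^2*t4^2 + t1^2*t3^2*t4^2 + t2^2*t3^2*t4^2"
    using assms by algebra
  ultimately show ?thesis
    unfolding P_A3_2 by (simp add: vec_eq_iff forall_3 c)
qed

section \<open>The critical set\<close>

lemma complex_jacobian_P_A3_2:
  "complex_jacobian (P_A3 2) p =
     vector [vector [2 * p$1, - 2, 0],
             vector [- 2 * p$3, 2 * p$2, - 2 * p$1],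
             vector [0, - 2, 2 * p$3]]"
proof -
  have lin: "deriv (\<lambda>w. a - 2 * w) x = - 2" for a x :: complex
    by (rule DERIV_imp_deriv) (auto intro!: derivative_eq_intros)
  have sq: "deriv (\<lambda>w. w^2 - a) x = 2 * x" for a x :: complex
    by (rule DERIV_imp_deriv) (auto intro!: derivative_eq_intros)
  have sq': "deriv (\<lambda>w. w^2 - a + 2) x = 2 * x" for a x :: complex
    by (rule DERIV_imp_deriv) (auto intro!: derivative_eq_intros)
  have l1: "deriv (\<lambda>w. a - 2 * w * b + 2) x = - 2 * b" for a b x :: complex
    by (rule DERIV_imp_deriv) (auto intro!: derivative_eq_intros)
  have l2: "deriv (\<lambda>w. a - 2 * b * w + 2) x = - 2 * b" for a b x :: complex
    by (rule DERIV_imp_deriv) (auto intro!: derivative_eq_intros)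
  show ?thesis
    unfolding complex_jacobian_def P_A3_2
    by (simp add: vec_eq_iff forall_3 lin sq sq' l1[simplified] l2[simplified])
qed

lemma critical_set_P_A3_2:
  "p \<in> critical_set (P_A3 2) \<longleftrightarrow> p$1 * p$2 * p$3 - (p$1)^2 - (p$3)^2 = 0"
proof -
  have "det (complex_jacobian (P_A3 2) p) = 8 * (p$1 * p$2 * p$3 - (p$1)^2 - (p$3)^2)"
    unfolding complex_jacobian_P_A3_2 det_3 by (simp add: algebra_simps power2_eq_square)
  then show ?thesis unfolding critical_set_def by (simp only: mem_Collect_eq mult_eq_0_iff) simp
qed

text \<open>The product of the three numbers \<open>(t\<^sub>i + t\<^sub>j)(t\<^sub>k + t\<^sub>l)\<close>, one for each way to split the
  roots into two pairs, is the symmetric function \<open>e\<^sub>1e\<^sub>2e\<^sub>3 - e\<^sub>3\<^sup>2 - e\<^sub>1\<^sup>2e\<^sub>4\<close>. With \<open>e\<^sub>4 = 1\<close> this is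
  the Jacobian determinant up to the factor 8.\<close>

lemma Phi1_critical_iff:
  assumes "t1 * t2 * t3 * t4 = 1"
  shows "Phi1 t1 t2 t3 \<in> critical_set (P_A3 2) \<longleftrightarrow>
    (t1 + t2) * (t1 + t3) * (t1 + t4) * (t2 + t3) * (t2 + t4) * (t3 + t4) = 0"
proof -
  have "(t1 + t2 + t3 + t4) * (t1*t2 + t1*t3 + t1*t4 + t2*t3 + t2*t4 + t3*t4)
      * (t1*t2*t3 + t1*t2*t4 + t1*t3*t4 + t2*t3*t4)
      - (t1 + t2 + t3 + t4)^2 - (t1*t2*t3 + t1*t2*t4 + t1*t3*t4 + t2*t3*t4)^2
    = (t1 + t2) * (t1 + t3) * (t1 + t4) * (t2 + t3) * (t2 + t4) * (t3 + t4)"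
    using assms by algebra
  then show ?thesis
    unfolding critical_set_P_A3_2 Phi1_components[OF assms] by simp
qed

section \<open>The critical values as a discriminant locus\<close>

lemma Phi1_discriminant:
  assumes "t1 * t2 * t3 * t4 = 1"
  defines "z \<equiv> Phi1 t1 t2 t3"
  shows "quartic_discriminant 1 (- (z$1) / 4) (z$2 / 6) (- (z$3) / 4) 1 =
    ((t1 - t2) * (t1 - t3) * (t1 - t4) * (t2 - t3) * (t2 - t4) * (t3 - t4))^2"
  using quartic_discriminant_roots
    [of "- (z$1) / 4" 1 t1 t2 t3 t4 "z$2 / 6" "- (z$3) / 4" 1] assms(1)
  by (simp add: z_def Phi1_components[OF assms(1)])

text \<open>Two sign patterns suffice to turn every coincidence \<open>s\<^sub>i = s\<^sub>j\<close> into an opposite pair: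
  changing the signs of \<open>s\<^sub>1, s\<^sub>2\<close> settles all pairs except \<open>{1,2}\<close> and \<open>{3,4}\<close>, and changing those
  of \<open>s\<^sub>1, s\<^sub>3\<close> settles these two.\<close>

lemma image_critical_set_P_A3_2:
  "z \<in> P_A3 2 ` critical_set (P_A3 2) \<longleftrightarrow>
     quartic_discriminant 1 (- (z$1) / 4) (z$2 / 6) (- (z$3) / 4) 1 = 0" (is "?L \<longleftrightarrow> ?R")
proof
  assume ?L
  then obtain p where p: "p \<in> critical_set (P_A3 2)" "z = P_A3 2 p" by blast
  obtain t1 t2 t3 t4 where t: "t1 * t2 * t3 * t4 = 1" "Phi1 t1 t2 t3 = p"
    by (rule Phi1_surj_unimodular)
  have sq: "t1^2 * t2^2 * t3^2 * t4^2 = 1"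
    using t(1) by (simp flip: power_mult_distrib)
  have z: "z = Phi1 (t1^2) (t2^2) (t3^2)"
    using p(2) t P_A3_2_Phi1 by metis
  have "(t1 + t2) * (t1 + t3) * (t1 + t4) * (t2 + t3) * (t2 + t4) * (t3 + t4) = 0"
    using Phi1_critical_iff[OF t(1)] t(2) p(1) by simp
  then have "(t1^2 - t2^2) * (t1^2 - t3^2) * (t1^2 - t4^2) * (t2^2 - t3^2) * (t2^2 - t4^2) * (t3^2 - t4^2) = 0"
    by (auto simp: power2_eq_iff add_eq_0_iff2)
  then show ?R
    unfolding z Phi1_discriminant[OF sq] by simp
next
  assume R: ?R
  obtain T1 T2 T3 T4 where T: "T1 * T2 * T3 * T4 = 1" "Phi1 T1 T2 T3 = z"
    by (rule Phi1_surj_unimodular)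
  define s1 s2 s3 where s: "s1 = csqrt T1" "s2 = csqrt T2" "s3 = csqrt T3"
  define s4 where "s4 = 1 / (s1 * s2 * s3)"
  have sq: "s1^2 = T1" "s2^2 = T2" "s3^2 = T3" by (simp_all add: s)
  have "s1 * s2 * s3 \<noteq> 0" using T(1) sq by auto
  then have S: "s1 * s2 * s3 * s4 = 1" by (simp add: s4_def)
  then have S2: "s1^2 * s2^2 * s3^2 * s4^2 = 1" by (simp flip: power_mult_distrib)
  have z: "z = Phi1 (s1^2) (s2^2) (s3^2)" using T(2) sq by simp
  have img: "?L" if "t1 * t2 * t3 * t4 = 1" "t1^2 = s1^2" "t2^2 = s2^2" "t3^2 = s3^2"
    "(t1 + t2) * (t1 + t3) * (t1 + t4) * (t2 + t3) * (t2 + t4) * (t3 + t4) = 0" for t1 t2 t3 t4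
    using P_A3_2_Phi1[OF that(1)] Phi1_critical_iff[OF that(1)] that(2-5) z by (metis image_eqI)
  have "(s1^2 - s2^2) * (s1^2 - s3^2) * (s1^2 - s4^2) * (s2^2 - s3^2) * (s2^2 - s4^2) * (s3^2 - s4^2) = 0"
    using R unfolding z Phi1_discriminant[OF S2] by simp
  then consider
      "(s1 + s2) * (s1 + s3) * (s1 + s4) * (s2 + s3) * (s2 + s4) * (s3 + s4) = 0"
    | "s1 = s3 \<or> s1 = s4 \<or> s2 = s3 \<or> s2 = s4"
    | "s1 = s2 \<or> s3 = s4"
    by (auto simp: power2_eq_iff add_eq_0_iff2)
  then show ?L
  proof cases
    case 1
    then show ?thesis by (intro img[of s1 s2 s3 s4] S) auto
  next
    case 2
    then show ?thesis using S by (intro img[of "- s1" "- s2" s3 s4]) auto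
  next
    case 3
    then show ?thesis using S by (intro img[of "- s1" s2 "- s3" s4]) auto
  qed
qed

section \<open>The Holy Grail\<close>

text \<open>The substitution \<open>(x, y) \<mapsto> (x + iy, x - iy)\<close> has determinant \<open>-2i\<close>. As \<open>I\<close> and \<open>J\<close> are invariants
  of degrees 2 and 3 and of weights 4 and 6, the real form has the invariants
  \<open>(-2i)^4 / 2^2 = 4\<close> and \<open>(-2i)^6 / 2^3 = -8\<close> times those of the complex one, the denominators
  coming from the factor \<open>1/2\<close> in the real part. Hence the discriminants have ratio 64.\<close>

lemma grail_discriminant:
  "of_real (quartic_discriminant (1 + Re \<beta> + \<gamma>) (- Im \<beta> / 2) (\<gamma> / 3 - 1) (- Im \<beta> / 2) (1 - Re \<beta> + \<gamma>)) =
     64 * quartic_discriminant 1 (\<beta> / 4) (of_real (2 * \<gamma>) / 6) (cnj \<beta> / 4) 1"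
proof -
  define u v g where uvg: "u = complex_of_real (Re \<beta>)" "v = complex_of_real (Im \<beta>)" "g = complex_of_real \<gamma>"
  have \<beta>: "\<beta> = u + \<i> * v" "cnj \<beta> = u - \<i> * v"
    by (simp_all add: uvg complex_eq_iff)
  have i2: "\<i> * \<i> = - 1" by simp
  have ratio: "256 * (i^3 - 27 * j^2) = 64 * (256 * (i'^3 - 27 * j'^2))"
    if "i = 4 * i'" "j = - 8 * j'" for i j i' j' :: complex
    unfolding that by (simp add: power_mult_distrib algebra_simps)
  have "quartic_discriminant (1 + u + g) (- v / 2) (g / 3 - 1) (- v / 2) (1 - u + g)
      = 64 * quartic_discriminant 1 ((u + \<i> * v) / 4) (2 * g / 6) ((u - \<i> * v) / 4) 1"
    unfolding quartic_discriminant_def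
  proof (rule ratio)
    show "(1 + u + g) * (1 - u + g) - 4 * (- v / 2) * (- v / 2) + 3 * (g / 3 - 1)^2
      = 4 * (1 * 1 - 4 * ((u + \<i> * v) / 4) * ((u - \<i> * v) / 4) + 3 * (2 * g / 6)^2)"
      using i2 by (simp add: field_simps) algebra
    show "(1 + u + g) * (g / 3 - 1) * (1 - u + g) + 2 * (- v / 2) * (g / 3 - 1) * (- v / 2)
        - (1 + u + g) * (- v / 2)^2 - (- v / 2)^2 * (1 - u + g) - (g / 3 - 1)^3
      = - 8 * (1 * (2 * g / 6) * 1 + 2 * ((u + \<i> * v) / 4) * (2 * g / 6) * ((u - \<i> * v) / 4)
        - 1 * ((u - \<i> * v) / 4)^2 - ((u + \<i> * v) / 4)^2 * 1 - (2 * g / 6)^3)"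
      by (simp add: field_simps power2_eq_square power3_eq_cube)
  qed
  moreover have "of_real (quartic_discriminant (1 + Re \<beta> + \<gamma>) (- Im \<beta> / 2) (\<gamma> / 3 - 1) (- Im \<beta> / 2) (1 - Re \<beta> + \<gamma>))
    = quartic_discriminant (1 + u + g) (- v / 2) (g / 3 - 1) (- v / 2) (1 - u + g)"
    by (simp add: quartic_discriminant_def uvg)
  moreover have "2 * g = of_real (2 * \<gamma>)" by (simp add: uvg(3))
  ultimately show ?thesis by (simp only: \<beta>[symmetric])
qed

lemma holy_grail_iff:
  "(\<beta>, \<gamma>) \<in> holy_grail \<longleftrightarrow>
     quartic_discriminant 1 (\<beta> / 4) (of_real (2 * \<gamma>) / 6) (cnj \<beta> / 4) 1 = 0"
proof -
  have "(\<beta>, \<gamma>) \<in> holy_grail \<longleftrightarrow>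
    quartic_discriminant (1 + Re \<beta> + \<gamma>) (- Im \<beta> / 2) (\<gamma> / 3 - 1) (- Im \<beta> / 2) (1 - Re \<beta> + \<gamma>) = 0"
    (is "_ \<longleftrightarrow> ?D = 0")
  proof
    assume "(\<beta>, \<gamma>) \<in> holy_grail"
    then obtain a b c d e where q: "quartic_discriminant a b c d e = 0"
      and "\<forall>x y. quartic_form a b c d e x y = quartic_form (1 + Re \<beta> + \<gamma>) (- Im \<beta> / 2)
        (\<gamma> / 3 - 1) (- Im \<beta> / 2) (1 - Re \<beta> + \<gamma>) x y"
      unfolding holy_grail_def grail_form_coefficients by blast
    from q quartic_form_coefficients_unique[OF this(2)] show "?D = 0" by simp
  next
    assume "?D = 0"
    then show "(\<beta>, \<gamma>) \<in> holy_grail"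
      unfolding holy_grail_def using grail_form_coefficients by blast
  qed
  also have "\<dots> \<longleftrightarrow> complex_of_real ?D = 0" by simp
  finally show ?thesis unfolding grail_discriminant by simp
qed

theorem proposition5p8:
  fixes f :: "complex^3 \<Rightarrow> complex^3" and C :: "(complex^3) set"
  assumes f: "f = P_A3 2" and C: "C = critical_set f"
  shows "(\<lambda>(\<beta>, \<gamma>). vector [- \<beta>, of_real (2 * \<gamma>), - cnj \<beta>]) ` holy_grail = f ` C \<inter> R3
    \<and> (\<forall>(\<beta>::complex) (\<gamma>::real).
         (\<beta>, \<gamma>) \<in> holy_grail \<longleftrightarrow> vector [- \<beta>, of_real (2 * \<gamma>), - cnj \<beta>] \<in> f ` C \<inter> R3)"
proof -
  let ?g = "\<lambda>(\<beta>, \<gamma>). vector [- \<beta>, of_real (2 * \<gamma>), - cnj \<beta>] :: complex^3"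
  have R3: "R3 = range ?g"
  proof
    have "vector [z1, of_real z2, cnj z1] = ?g (- z1, z2 / 2)" for z1 z2 by simp
    then show "R3 \<subseteq> range ?g" unfolding R3_def by blast
    have "?g (\<beta>, \<gamma>) = vector [- \<beta>, of_real (2 * \<gamma>), cnj (- \<beta>)]" for \<beta> \<gamma> by simp
    then have "?g (\<beta>, \<gamma>) \<in> R3" for \<beta> \<gamma> unfolding R3_def by blast
    then have "?g x \<in> R3" for x by (cases x) (simp only:)
    then show "range ?g \<subseteq> R3" by (rule image_subsetI)
  qed
  have iff: "x \<in> holy_grail \<longleftrightarrow> ?g x \<in> f ` C" for x
    unfolding C f image_critical_set_P_A3_2 by (cases x) (simp add: holy_grail_iff del: of_real_mult)
  have "?g ` holy_grail = f ` C \<inter> R3"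
  proof -
    have preimage: "holy_grail = ?g -` (f ` C)"
      by (rule set_eqI) (simp only: vimage_eq iff)
    show ?thesis unfolding R3 preimage by (rule image_vimage_eq)
  qed
  moreover have "(\<beta>, \<gamma>) \<in> holy_grail \<longleftrightarrow> vector [- \<beta>, of_real (2 * \<gamma>), - cnj \<beta>] \<in> f ` C \<inter> R3" for \<beta> \<gamma>
  proof -
    have "?g (\<beta>, \<gamma>) \<in> R3" unfolding R3 by (rule rangeI)
    then show ?thesis using iff[of "(\<beta>, \<gamma>)"] by (simp only: Int_iff prod.case simp_thms)
  qed
  ultimately show ?thesis by blast
qed

end
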